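(* The left overlap division $\mathcal O$ is a weak involutive division; that is, it does not satisfy all the conditions defining a strong involutive division.
   Context: Monomials are words in the noncommuting variables $x_1,\dots,x_n$ of a noncommutative polynomial ring (the division $\mathcal O$ is defined for every such ring; failure of strongness in some such ring, e.g. with three variables, is what is meant). An involutive division is a rule $I$ assigning to every finite set $U$ of monomials and every $u\in U$ a set $\mathcal M^L_I(u,U)\subseteq\{x_1,\dots,x_n\}$ of left multiplicative variables and a set $\mathcal M^R_I(u,U)\subseteq\{x_1,\dots,x_n\}$ of right multiplicative variables. For $u\in U$ and a factorisation $w=v_1uv_2$, $u$ is an involutive divisor of $w$ at this factorisation if (thin divisors) the last letter of $v_1$ (if $v_1\ne1$) is in $\mathcal M^L_I(u,U)$ and the first letter of $v_2$ (if $v_2\neq1$) is in $\mathcal M^R_I(u,U)$. Write $u\mid_I w$ if this holds for some factorisation, and let $\mathcal C_I(u,U)=\{w : u\mid_I w\}$. $I$ is strong if for every finite $U$: (Disjoint Cones) if $\mathcal C_I(u_1,U)\cap\mathcal C_I(u_2,U)\ne\emptyset$ for $u_1,u_2\in U$, then one of these cones is contained in the other; (Unique Divisor) each $w\in\mathcal C_I(u,U)$ is involutively divisible by $u$ at exactly one factorisation; (Subset) if $V\subset U$ then $\mathcal M^L_I(v,U)\subseteq\mathcal M^L_I(v,V)$ and $\mathcal M^R_I(v,U)\subseteq\mathcal M^R_I(v,V)$ for all $v\in V$. If any of these conditions is not satisfied, $I$ is weak. Left overlap division $\mathcal O$. Let $U$ be a finite set of monomials. All variables are left multiplicative for all elements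 of $U$. All variables are right multiplicative except those made right nonmultiplicative by the following rules: (a) whenever $u_j\in U$ occurs as a subword of a different $u_i\in U$ at a position that is not the suffix position, the letter of $u_i$ immediately to the right of that occurrence is right nonmultiplicative for $u_j$; (b) whenever $u_i,u_j\in U$ (possibly equal) and $1\le k<\min(\deg u_i,\deg u_j)$ are such that the prefix of $u_i$ of length $k$ equals the suffix of $u_j$ of length $k$, the $(k+1)$-st letter of $u_i$ is right nonmultiplicative for $u_j$. *)

theory Defs
  imports Main
begin

text \<open>The variable \<open>x\<^sub>i\<close> is the number \<open>i\<close>, and a monomial is the list of its letters, the
  empty list being the monomial \<open>1\<close>. Only variables \<open>x\<^sub>1, \<dots>, x\<^sub>n\<close> belong to the ring, so every
  notion below is relativised to a number \<open>n\<close> of variables.\<close>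

type_synonym monomial = "nat list"

definition vars :: "nat \<Rightarrow> nat set" where
  "vars n = {1..n}"

definition monomials :: "nat \<Rightarrow> monomial set" where
  "monomials n = lists (vars n)"

text \<open>A division maps \<open>U\<close> and \<open>u\<close> to the pair of the left and the right multiplicative variables.
  Its values matter only for finite \<open>U \<subseteq> monomials n\<close> and \<open>u \<in> U\<close>.\<close>

type_synonym division = "monomial set \<Rightarrow> monomial \<Rightarrow> nat set \<times> nat set"

definition left_mult :: "division \<Rightarrow> monomial \<Rightarrow> monomial set \<Rightarrow> nat set" where
  "left_mult I u U = fst (I U u)"

definition right_mult :: "division \<Rightarrow> monomial \<Rightarrow> monomial set \<Rightarrow> nat set" where
  "right_mult I u U = snd (I U u)"

definition involutive_division :: "nat \<Rightarrow> division \<Rightarrow> bool" where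
  "involutive_division n I \<longleftrightarrow>
     (\<forall>U u. finite U \<and> U \<subseteq> monomials n \<and> u \<in> U \<longrightarrow>
        left_mult I u U \<subseteq> vars n \<and> right_mult I u U \<subseteq> vars n)"

definition inv_divides_at ::
    "division \<Rightarrow> monomial set \<Rightarrow> monomial \<Rightarrow> monomial \<Rightarrow> monomial \<Rightarrow> monomial \<Rightarrow> bool" where
  "inv_divides_at I U u w v1 v2 \<longleftrightarrow>
     w = v1 @ u @ v2 \<and>
     (v1 \<noteq> [] \<longrightarrow> last v1 \<in> left_mult I u U) \<and>
     (v2 \<noteq> [] \<longrightarrow> hd v2 \<in> right_mult I u U)"

definition cone :: "nat \<Rightarrow> division \<Rightarrow> monomial \<Rightarrow> monomial set \<Rightarrow> monomial set" where
  "cone n I u U = {w \<in> monomials n. \<exists>v1 v2. inv_divides_at I U u w v1 v2}"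

definition disjoint_cones :: "nat \<Rightarrow> division \<Rightarrow> monomial set \<Rightarrow> bool" where
  "disjoint_cones n I U \<longleftrightarrow>
     (\<forall>u1\<in>U. \<forall>u2\<in>U. cone n I u1 U \<inter> cone n I u2 U \<noteq> {} \<longrightarrow>
        cone n I u1 U \<subseteq> cone n I u2 U \<or> cone n I u2 U \<subseteq> cone n I u1 U)"

definition unique_divisor :: "nat \<Rightarrow> division \<Rightarrow> monomial set \<Rightarrow> bool" where
  "unique_divisor n I U \<longleftrightarrow>
     (\<forall>u\<in>U. \<forall>w\<in>cone n I u U. \<exists>!(v1, v2). inv_divides_at I U u w v1 v2)"

definition subset_condition :: "division \<Rightarrow> monomial set \<Rightarrow> bool" where
  "subset_condition I U \<longleftrightarrow>
     (\<forall>V. V \<subset> U \<longrightarrow> (\<forall>v\<in>V. left_mult I v U \<subseteq> left_mult I v V \<and>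
                            right_mult I v U \<subseteq> right_mult I v V))"

definition strong_involutive_division :: "nat \<Rightarrow> division \<Rightarrow> bool" where
  "strong_involutive_division n I \<longleftrightarrow>
     involutive_division n I \<and>
     (\<forall>U. finite U \<and> U \<subseteq> monomials n \<longrightarrow>
        disjoint_cones n I U \<and> unique_divisor n I U \<and> subset_condition I U)"

definition weak_involutive_division :: "nat \<Rightarrow> division \<Rightarrow> bool" where
  "weak_involutive_division n I \<longleftrightarrow>
     involutive_division n I \<and> \<not> strong_involutive_division n I"

text \<open>In the first set the letter \<open>x\<close> exists exactly when the occurrence of \<open>uj\<close> in \<open>ui\<close> is not at
  the suffix position. In the second one \<open>ui ! k\<close> is the \<open>(k + 1)\<close>-st letter of \<open>ui\<close>.\<close>

definition subword_nonmult :: "monomial set \<Rightarrow> monomial \<Rightarrow> nat set" where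
  "subword_nonmult U uj = {x. \<exists>ui\<in>U. ui \<noteq> uj \<and> (\<exists>p s. ui = p @ uj @ [x] @ s)}"

definition overlap_nonmult :: "monomial set \<Rightarrow> monomial \<Rightarrow> nat set" where
  "overlap_nonmult U uj =
     {ui ! k | ui k. ui \<in> U \<and> 1 \<le> k \<and> k < min (length ui) (length uj) \<and>
                     take k ui = drop (length uj - k) uj}"

definition left_overlap_division :: "nat \<Rightarrow> division" where
  "left_overlap_division n U u =
     (vars n, vars n - (subword_nonmult U u \<union> overlap_nonmult U u))"

end

theory Submission
  imports Defs
begin

text \<open>Neither rule of the division makes a letter \<open>x\<close> right nonmultiplicative for \<open>x\<close> itself
  with respect to \<open>{x}\<close>, since an overlap has to be shorter than both words. Hence \<open>x\<close> divides
  \<open>xx\<close> involutively both as its prefix and as its suffix, and Unique Divisor fails.\<close>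

lemma involutive_division_left_overlap: "involutive_division n (left_overlap_division n)"
  by (auto simp: involutive_division_def left_mult_def right_mult_def left_overlap_division_def)

text \<open>The subword rule needs a second word in the set, and the overlap rule would need
  \<open>1 \<le> k < 1\<close>.\<close>

lemma left_overlap_division_letter:
  "left_overlap_division n {[x]} [x] = (vars n, vars n)"
  by (auto simp: left_overlap_division_def subword_nonmult_def overlap_nonmult_def)

lemma not_unique_divisor_left_overlap_letter:
  assumes "x \<in> vars n"
  shows "\<not> unique_divisor n (left_overlap_division n) {[x]}"
proof
  let ?D = "inv_divides_at (left_overlap_division n) {[x]} [x] [x, x]"
  assume unique: "unique_divisor n (left_overlap_division n) {[x]}"
  \<comment> \<open>The first factorisation needs \<open>x\<close> to be right multiplicative, the
    second needs it to be left multiplicative.\<close>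
  have prefix: "?D [] [x]" and suffix: "?D [x] []"
    using assms
    by (simp_all add: inv_divides_at_def left_mult_def right_mult_def left_overlap_division_letter)
  from assms prefix have "[x, x] \<in> cone n (left_overlap_division n) [x] {[x]}"
    by (auto simp: cone_def monomials_def)
  with unique have "\<exists>!(v1, v2). ?D v1 v2"
    by (simp add: unique_divisor_def)
  with prefix suffix show False
    by auto
qed

text \<open>The bound provides a variable. For \<open>n = 0\<close> the empty word is the only
  monomial and the division is strong.\<close>

lemma weak_involutive_division_left_overlap:
  assumes "n \<ge> 1"
  shows "weak_involutive_division n (left_overlap_division n)"
proof -
  from assms have "1 \<in> vars n"
    by (simp add: vars_def)
  moreover from this have "finite {[1]}" "{[1]} \<subseteq> monomials n"
    by (simp_all add: monomials_def)
  ultimately show ?thesis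
    using not_unique_divisor_left_overlap_letter involutive_division_left_overlap
    unfolding weak_involutive_division_def strong_involutive_division_def by blast
qed

theorem proposition5p5p15:
  shows "(\<forall>n. involutive_division n (left_overlap_division n)) \<and>
         (\<exists>n. weak_involutive_division n (left_overlap_division n))"
  using involutive_division_left_overlap weak_involutive_division_left_overlap by blast

end
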